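(* (1) For every set of labels $\mathbb{U}$, every cycle property $Y\subseteq\mathbb{U}^*$ and every arena $\mathcal{A}=(V_0,V_1,E,\mathbb{U},\lambda)$ with $V_0=\emptyset$ or $V_1=\emptyset$, the game $(\mathcal{A},O_{\mathrm{FC}(Y)}(\mathcal{A}))$ is pointwise memoryless determined. (2) There exist a cycle property $Y$ and an arena $\mathcal{A}$ with $V_0=\emptyset$ or $V_1=\emptyset$ such that the game $(\mathcal{A},O_{\mathrm{FC}(Y)}(\mathcal{A}))$ is not uniform memoryless determined. (3) Let $Y\subseteq\mathbb{U}^*$ be a cycle property closed under cyclic permutations, let $\mathcal{A}$ be an arena with labels in $\mathbb{U}$, and let $i\in\{0,1\}$. If the game $(\mathcal{A},O_{\mathrm{FC}(Y)}(\mathcal{A}))$ is pointwise memoryless for Player $i$, then it is uniform memoryless for Player $i$.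
   Context: An arena is a tuple $\mathcal{A}=(V_0,V_1,E,\mathbb{U},\lambda)$ where $V_0,V_1$ are disjoint finite sets (the vertices of Player 0 and Player 1) with $V:=V_0\cup V_1$ non-empty, $E\subseteq V\times V$ is a set of edges such that every vertex has at least one outgoing edge, $\mathbb{U}$ is a set of labels, and $\lambda:E\to\mathbb{U}$. For a sequence of edges $u=e_1e_2\cdots$, write $\lambda(u)=\lambda(e_1)\lambda(e_2)\cdots$. A play is an infinite sequence $\pi=\pi_0\pi_1\cdots$ of vertices with $(\pi_j,\pi_{j+1})\in E$ for all $j$; $\mathrm{plays}(\mathcal{A})$ is the set of plays. A strategy for Player $i$ is a function $S:V^*V_i\to V$ with $(v,S(uv))\in E$ for all $u\in V^*$, $v\in V_i$; it is memoryless if $S(uv)=S(u'v)$ for all $u,u'\in V^*$, $v\in V_i$. A play is consistent with a strategy $S$ of Player $i$ if $\pi_{j+1}=S(\pi_0\cdots\pi_j)$ whenever $\pi_j\in V_i$. A game is a pair $(\mathcal{A},O)$ with $O\subseteq\mathrm{plays}(\mathcal{A})$; a play is won by Player 0 if it is in $O$ and by Player 1 otherwise. A strategy for Player $i$ is winning from $v$ if every play starting at $v$ consistent with it is won by Player $i$. The winning region of Player $i$ is the set of vertices from which Player $i$ has a winning strategy. The game is determined if the two winning regions partition $V$. It is pointwise memoryless for Player $i$ if from every vertex of Player $i$'s winning region Player $i$ has a memoryless winning strategy; it is uniform memoryless for Player $i$ if there is one memoryless strategy for Player $i$ that is winning from every vertex of Player $i$'s winning region. It is pointwise (resp. uniform)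 memoryless determined if it is determined and pointwise (resp. uniform) memoryless for both players. A cycle is a sequence of edges $(v_1,v_2)(v_2,v_3)\cdots(v_{k-1},v_k)(v_k,v_1)$. The cycles-decomposition $\mathrm{cycles}(\pi)$ of a play $\pi$ is the sequence of cycles output by the following procedure: start with an empty stack; at step $j=0,1,2,\dots$ push the edge $(\pi_j,\pi_{j+1})$, and if for some $k$ the top $k$ edges of the stack form a cycle, pop this cycle and output it. The first cycle of $\pi$ is the first cycle in $\mathrm{cycles}(\pi)$. A cycle property is a set $Y\subseteq\mathbb{U}^*$. $Y$ is closed under cyclic permutations if $ab\in Y$ implies $ba\in Y$ for all $a\in\mathbb{U}$, $b\in\mathbb{U}^*$. $O_{\mathrm{FC}(Y)}(\mathcal{A})$ is the set of plays $\pi$ such that $\lambda(u)\in Y$, where $u$ is the first cycle of $\pi$. *)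

theory Defs
  imports "HOL-Library.Infinite_Set"
begin

datatype player = Player0 | Player1

record ('v, 'l) arena =
  vertices0 :: "'v set"
  vertices1 :: "'v set"
  edges :: "('v \<times> 'v) set"
  labels :: "'l set"
  label :: "'v \<times> 'v \<Rightarrow> 'l"

definition vertices :: "('v, 'l) arena \<Rightarrow> 'v set" where
  "vertices A = vertices0 A \<union> vertices1 A"

fun vertices_of :: "('v, 'l) arena \<Rightarrow> player \<Rightarrow> 'v set" where
  "vertices_of A Player0 = vertices0 A"
| "vertices_of A Player1 = vertices1 A"

definition wf_arena :: "('v, 'l) arena \<Rightarrow> bool" where
  "wf_arena A \<longleftrightarrow>
     finite (vertices0 A) \<and> finite (vertices1 A) \<and>
     vertices0 A \<inter> vertices1 A = {} \<and> vertices A \<noteq> {} \<and>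
     edges A \<subseteq> vertices A \<times> vertices A \<and>
     (\<forall>v \<in> vertices A. \<exists>w. (v, w) \<in> edges A) \<and>
     (\<forall>e \<in> edges A. label A e \<in> labels A)"

definition plays :: "('v, 'l) arena \<Rightarrow> (nat \<Rightarrow> 'v) set" where
  "plays A = {\<pi>. \<forall>j. (\<pi> j, \<pi> (Suc j)) \<in> edges A}"

text \<open>
  A strategy is a total function on lists, of which only the values on the words of
  \<open>V\<^sup>* V\<^sub>i\<close> are constrained or used.
\<close>

definition strategy :: "('v, 'l) arena \<Rightarrow> player \<Rightarrow> ('v list \<Rightarrow> 'v) \<Rightarrow> bool" where
  "strategy A i S \<longleftrightarrow>
     (\<forall>u \<in> lists (vertices A). \<forall>v \<in> vertices_of A i. (v, S (u @ [v])) \<in> edges A)"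

definition memoryless :: "('v, 'l) arena \<Rightarrow> player \<Rightarrow> ('v list \<Rightarrow> 'v) \<Rightarrow> bool" where
  "memoryless A i S \<longleftrightarrow>
     (\<forall>u \<in> lists (vertices A). \<forall>u' \<in> lists (vertices A). \<forall>v \<in> vertices_of A i.
        S (u @ [v]) = S (u' @ [v]))"

definition consistent ::
    "('v, 'l) arena \<Rightarrow> player \<Rightarrow> ('v list \<Rightarrow> 'v) \<Rightarrow> (nat \<Rightarrow> 'v) \<Rightarrow> bool" where
  "consistent A i S \<pi> \<longleftrightarrow>
     (\<forall>j. \<pi> j \<in> vertices_of A i \<longrightarrow> \<pi> (Suc j) = S (map \<pi> [0..<Suc j]))"

text \<open>
  A game is given by an arena \<open>A\<close> together with an objective \<open>W \<subseteq> plays A\<close>.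
\<close>

fun won_by :: "(nat \<Rightarrow> 'v) set \<Rightarrow> player \<Rightarrow> (nat \<Rightarrow> 'v) \<Rightarrow> bool" where
  "won_by W Player0 \<pi> \<longleftrightarrow> \<pi> \<in> W"
| "won_by W Player1 \<pi> \<longleftrightarrow> \<pi> \<notin> W"

definition winning_from ::
    "('v, 'l) arena \<Rightarrow> (nat \<Rightarrow> 'v) set \<Rightarrow> player \<Rightarrow> ('v list \<Rightarrow> 'v) \<Rightarrow> 'v \<Rightarrow> bool" where
  "winning_from A W i S v \<longleftrightarrow>
     (\<forall>\<pi> \<in> plays A. \<pi> 0 = v \<and> consistent A i S \<pi> \<longrightarrow> won_by W i \<pi>)"

definition winning_region ::
    "('v, 'l) arena \<Rightarrow> (nat \<Rightarrow> 'v) set \<Rightarrow> player \<Rightarrow> 'v set" where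
  "winning_region A W i =
     {v \<in> vertices A. \<exists>S. strategy A i S \<and> winning_from A W i S v}"

definition determined :: "('v, 'l) arena \<Rightarrow> (nat \<Rightarrow> 'v) set \<Rightarrow> bool" where
  "determined A W \<longleftrightarrow>
     winning_region A W Player0 \<union> winning_region A W Player1 = vertices A \<and>
     winning_region A W Player0 \<inter> winning_region A W Player1 = {}"

definition pointwise_memoryless ::
    "('v, 'l) arena \<Rightarrow> (nat \<Rightarrow> 'v) set \<Rightarrow> player \<Rightarrow> bool" where
  "pointwise_memoryless A W i \<longleftrightarrow>
     (\<forall>v \<in> winning_region A W i.
        \<exists>S. strategy A i S \<and> memoryless A i S \<and> winning_from A W i S v)"

definition uniform_memoryless ::
    "('v, 'l) arena \<Rightarrow> (nat \<Rightarrow> 'v) set \<Rightarrow> player \<Rightarrow> bool" where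
  "uniform_memoryless A W i \<longleftrightarrow>
     (\<exists>S. strategy A i S \<and> memoryless A i S \<and>
        (\<forall>v \<in> winning_region A W i. winning_from A W i S v))"

definition pointwise_memoryless_determined ::
    "('v, 'l) arena \<Rightarrow> (nat \<Rightarrow> 'v) set \<Rightarrow> bool" where
  "pointwise_memoryless_determined A W \<longleftrightarrow>
     determined A W \<and> (\<forall>i. pointwise_memoryless A W i)"

definition uniform_memoryless_determined ::
    "('v, 'l) arena \<Rightarrow> (nat \<Rightarrow> 'v) set \<Rightarrow> bool" where
  "uniform_memoryless_determined A W \<longleftrightarrow>
     determined A W \<and> (\<forall>i. uniform_memoryless A W i)"

text \<open>
  Membership in the edge set of an arena is not part of this definition: it is only
  applied to lists of pairs that are traversed by a play. Cycles of length one
  (self-loops) are cycles, and cycles need not be simple.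
\<close>

definition is_cycle :: "('v \<times> 'v) list \<Rightarrow> bool" where
  "is_cycle es \<longleftrightarrow>
     es \<noteq> [] \<and> successively (\<lambda>e f. snd e = fst f) es \<and> snd (last es) = fst (hd es)"

text \<open>
  Stacks are lists whose last element is the top, so that a stack lists edges in the order
  in which they are traversed. After every step the stack is a path without repeated
  vertices; hence at most one \<open>k\<close> qualifies after the next push, and the use of \<open>LEAST\<close>
  below involves no choice.
\<close>

definition top_edges :: "nat \<Rightarrow> ('v \<times> 'v) list \<Rightarrow> ('v \<times> 'v) list" where
  "top_edges k s = drop (length s - k) s"

definition cycle_on_top :: "('v \<times> 'v) list \<Rightarrow> nat \<Rightarrow> bool" where
  "cycle_on_top s k \<longleftrightarrow> k \<le> length s \<and> is_cycle (top_edges k s)"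

definition pop_cycle :: "('v \<times> 'v) list \<Rightarrow> ('v \<times> 'v) list" where
  "pop_cycle s =
     (if \<exists>k. cycle_on_top s k then take (length s - (LEAST k. cycle_on_top s k)) s else s)"

definition output_cycle :: "('v \<times> 'v) list \<Rightarrow> ('v \<times> 'v) list option" where
  "output_cycle s =
     (if \<exists>k. cycle_on_top s k then Some (top_edges (LEAST k. cycle_on_top s k) s) else None)"

text \<open>
  \<open>stack \<pi> j\<close> is the content of the stack before step \<open>j\<close>, and \<open>pushed \<pi> j\<close> its content
  during step \<open>j\<close>, after the push and before the possible pop.
\<close>

fun stack :: "(nat \<Rightarrow> 'v) \<Rightarrow> nat \<Rightarrow> ('v \<times> 'v) list" where
  "stack \<pi> 0 = []"
| "stack \<pi> (Suc j) = pop_cycle (stack \<pi> j @ [(\<pi> j, \<pi> (Suc j))])"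

definition pushed :: "(nat \<Rightarrow> 'v) \<Rightarrow> nat \<Rightarrow> ('v \<times> 'v) list" where
  "pushed \<pi> j = stack \<pi> j @ [(\<pi> j, \<pi> (Suc j))]"

definition output_steps :: "(nat \<Rightarrow> 'v) \<Rightarrow> nat set" where
  "output_steps \<pi> = {j. output_cycle (pushed \<pi> j) \<noteq> None}"

text \<open>
  A play visits only finitely many vertices, so the set of output steps is infinite and
  \<open>enumerate\<close> lists it in increasing order: \<open>cycles \<pi> n\<close> is the \<open>n\<close>-th cycle that is output,
  counting from \<open>0\<close>.
\<close>

definition cycles :: "(nat \<Rightarrow> 'v) \<Rightarrow> nat \<Rightarrow> ('v \<times> 'v) list" where
  "cycles \<pi> n = the (output_cycle (pushed \<pi> (enumerate (output_steps \<pi>) n)))"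

definition first_cycle :: "(nat \<Rightarrow> 'v) \<Rightarrow> ('v \<times> 'v) list" where
  "first_cycle \<pi> = cycles \<pi> 0"

definition cycle_property :: "'l set \<Rightarrow> 'l list set \<Rightarrow> bool" where
  "cycle_property U Y \<longleftrightarrow> Y \<subseteq> lists U"

definition closed_under_cyclic_permutations :: "'l set \<Rightarrow> 'l list set \<Rightarrow> bool" where
  "closed_under_cyclic_permutations U Y \<longleftrightarrow>
     (\<forall>a \<in> U. \<forall>b \<in> lists U. a # b \<in> Y \<longrightarrow> b @ [a] \<in> Y)"

definition O_FC :: "'l list set \<Rightarrow> ('v, 'l) arena \<Rightarrow> (nat \<Rightarrow> 'v) set" where
  "O_FC Y A = {\<pi> \<in> plays A. map (label A) (first_cycle \<pi>) \<in> Y}"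

end

theory Submission
  imports Defs
begin

text \<open>
  The first cycle of a play closes at its first repetition of a vertex. In a solitaire arena,
  following a winning play up to that repetition is a memoryless strategy.

  Suppose the cycle property is closed under cyclic permutations. If a memoryless strategy wins
  from \<open>v\<close>, it wins from every vertex \<open>w\<close> that can follow \<open>v\<close>: given a play from \<open>w\<close>, either \<open>v\<close> does
  not occur before the first repetition and can be put in front of the play, or some consistent
  play from \<open>v\<close> runs into the same cycle, possibly entering it at another vertex. Now enumerate
  the winning region and let each vertex use the strategy of the least \<open>v\<close> whose strategy reaches
  it. This least index never increases along a play, so it is constant on the first cycle, which
  is therefore also the first cycle of a play consistent with a single pointwise winning strategy.
\<close>

section \<open>Lassos and the first cycle of a play\<close>

definition segment :: "(nat \<Rightarrow> 'v) \<Rightarrow> nat \<Rightarrow> nat \<Rightarrow> ('v \<times> 'v) list" where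
  "segment \<pi> k m = map (\<lambda>i. (\<pi> i, \<pi> (Suc i))) [k..<m]"

text \<open>The first repetition of a vertex happens at time \<open>Suc j\<close>, when time
  \<open>k\<close> is revisited. The index \<open>j\<close> is also the step of the stack procedure
  whose push closes the first cycle.\<close>

definition lasso :: "(nat \<Rightarrow> 'v) \<Rightarrow> nat \<Rightarrow> nat \<Rightarrow> bool" where
  "lasso \<pi> k j \<longleftrightarrow> k \<le> j \<and> inj_on \<pi> {..j} \<and> \<pi> (Suc j) = \<pi> k"

lemma segment_Suc: "k \<le> m \<Longrightarrow> segment \<pi> k (Suc m) = segment \<pi> k m @ [(\<pi> m, \<pi> (Suc m))]"
  by (simp add: segment_def)

lemma segment_cong:
  "(\<And>i. k \<le> i \<Longrightarrow> i \<le> m \<Longrightarrow> \<pi> i = \<rho> i) \<Longrightarrow> segment \<pi> k m = segment \<rho> k m"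
  by (simp add: segment_def)

lemma segment_shift: "segment (\<lambda>n. \<pi> (n + l)) k m = segment \<pi> (k + l) (m + l)"
  by (rule nth_equalityI) (simp_all add: segment_def ac_simps)

lemma is_cycle_segment:
  assumes "k < m"
  shows "is_cycle (segment \<pi> k m) \<longleftrightarrow> \<pi> m = \<pi> k"
proof -
  have "successively (\<lambda>e f. snd e = fst f) (segment \<pi> k m)"
    by (simp add: segment_def successively_conv_nth)
  moreover have "last (segment \<pi> k m) = (\<pi> (m - 1), \<pi> m)" "fst (hd (segment \<pi> k m)) = \<pi> k"
    using assms by (simp_all add: segment_def last_map hd_map)
  ultimately show ?thesis
    using assms by (simp add: is_cycle_def segment_def)
qed

text \<open>Consecutive edges of a segment always match, so the two end vertices alone decide
  whether its top \<open>n\<close> edges form a cycle.\<close>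

lemma cycle_on_top_segment:
  "cycle_on_top (segment \<pi> 0 m) n \<longleftrightarrow> 0 < n \<and> n \<le> m \<and> \<pi> m = \<pi> (m - n)"
proof (cases "0 < n \<and> n \<le> m")
  case True
  then have "top_edges n (segment \<pi> 0 m) = segment \<pi> (m - n) m"
    by (simp add: top_edges_def segment_def drop_map)
  with True show ?thesis
    by (simp add: cycle_on_top_def is_cycle_segment) (simp add: segment_def)
next
  case False
  then show ?thesis
    by (auto simp: cycle_on_top_def top_edges_def segment_def is_cycle_def)
qed

lemma no_cycle_on_top_segment:
  assumes "inj_on \<pi> {..m}"
  shows "\<not> cycle_on_top (segment \<pi> 0 m) n"
proof
  assume "cycle_on_top (segment \<pi> 0 m) n"
  then have *: "0 < n" "n \<le> m" "\<pi> m = \<pi> (m - n)"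
    by (auto simp: cycle_on_top_segment)
  then have "m = m - n"
    by (intro inj_onD[OF assms]) auto
  with * show False by simp
qed

text \<open>A pop needs a repeated vertex; until one occurs, the stack holds the whole history of
  edges.\<close>

lemma stack_eq_segment:
  assumes "inj_on \<pi> {..j}" "i \<le> j"
  shows "stack \<pi> i = segment \<pi> 0 i"
  using assms(2)
proof (induction i)
  case (Suc i)
  have "\<not> cycle_on_top (segment \<pi> 0 (Suc i)) n" for n
    using assms(1) Suc.prems by (intro no_cycle_on_top_segment) (auto intro: inj_on_subset)
  with Suc show ?case
    by (simp add: pop_cycle_def segment_Suc)
qed (simp add: segment_def)

text \<open>Nothing is popped before step \<open>j\<close>, and at step \<open>j\<close> injectivity
  leaves \<open>Suc j - k\<close> as the only length of a cycle on top. This settles both least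
  elements in the definitions, the one choosing the step and the one choosing the length.\<close>

lemma first_cycle_lasso:
  assumes "lasso \<pi> k j"
  shows "first_cycle \<pi> = segment \<pi> k (Suc j)"
proof -
  have inj: "inj_on \<pi> {..j}" and k: "k \<le> j" "\<pi> (Suc j) = \<pi> k"
    using assms by (auto simp: lasso_def)
  have pushed: "pushed \<pi> i = segment \<pi> 0 (Suc i)" if "i \<le> j" for i
    using that by (simp add: pushed_def stack_eq_segment[OF inj] segment_Suc)
  have top: "cycle_on_top (pushed \<pi> j) n \<longleftrightarrow> n = Suc j - k" for n
  proof -
    have "\<pi> k = \<pi> (Suc j - n) \<longleftrightarrow> k = Suc j - n" if "0 < n"
      using inj k(1) that by (auto dest: inj_onD)
    then show ?thesis
      using k by (auto simp: pushed cycle_on_top_segment)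
  qed
  have "i \<notin> output_steps \<pi>" if "i < j" for i
  proof -
    have "\<not> cycle_on_top (pushed \<pi> i) n" for n
      using no_cycle_on_top_segment[of \<pi> "Suc i" n] inj_on_subset[OF inj, of "{..Suc i}"] that
      by (simp add: pushed)
    then show ?thesis
      by (simp add: output_steps_def output_cycle_def)
  qed
  moreover have "j \<in> output_steps \<pi>"
    by (simp add: output_steps_def output_cycle_def top)
  ultimately have "(LEAST n. n \<in> output_steps \<pi>) = j"
    by (intro Least_equality) (auto simp: not_less[symmetric])
  then have "first_cycle \<pi> = top_edges (Suc j - k) (pushed \<pi> j)"
    using Least_equality[of "cycle_on_top (pushed \<pi> j)" "Suc j - k"] top
    by (auto simp: first_cycle_def cycles_def enumerate_0 output_cycle_def)
  also have "\<dots> = segment \<pi> k (Suc j)"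
    using k(1) by (simp add: pushed top_edges_def segment_def drop_map del: upt_Suc)
  finally show ?thesis .
qed

text \<open>By pigeonhole some vertex repeats; at the least step that returns to an earlier vertex,
  the vertices visited so far are distinct.\<close>

lemma lasso_exists:
  assumes "finite (range \<pi>)"
  obtains k j where "lasso \<pi> k j"
proof -
  let ?P = "\<lambda>n. \<exists>k\<le>n. \<pi> (Suc n) = \<pi> k"
  have "\<not> inj \<pi>"
    using assms finite_imageD infinite_UNIV_nat by blast
  then obtain a b where "a < b" "\<pi> a = \<pi> b"
    by (metis injI linorder_neqE_nat)
  then have "?P (b - 1)"
    by (intro exI[of _ a]) auto
  then have ex: "?P (LEAST n. ?P n)"
    by (rule LeastI[of ?P])
  define j where "j = (LEAST n. ?P n)"
  have "\<pi> a \<noteq> \<pi> b" if "a < b" "b \<le> j" for a b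
  proof
    assume "\<pi> a = \<pi> b"
    with that have "?P (b - 1)"
      by (intro exI[of _ a]) auto
    then have "j \<le> b - 1"
      unfolding j_def by (rule Least_le)
    with that show False by simp
  qed
  then have "inj_on \<pi> {..j}"
    by (intro linorder_inj_onI) auto
  with ex that show ?thesis
    unfolding j_def lasso_def by blast
qed

lemma lasso_cong:
  assumes "lasso \<pi> k j" "\<And>n. n \<le> Suc j \<Longrightarrow> \<rho> n = \<pi> n"
  shows "lasso \<rho> k j"
  using assms inj_on_cong[of "{..j}" \<rho> \<pi>] by (auto simp: lasso_def)

section \<open>Unrolled lassos and windows of periodic sequences\<close>

definition unroll :: "(nat \<Rightarrow> 'v) \<Rightarrow> nat \<Rightarrow> nat \<Rightarrow> nat \<Rightarrow> 'v" where
  "unroll \<pi> k N n = \<pi> (if n < k then n else k + (n - k) mod N)"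

lemma unroll_period: "k \<le> n \<Longrightarrow> unroll \<pi> k N (n + N) = unroll \<pi> k N n"
  by (auto simp: unroll_def le_iff_add add.assoc)

lemma unroll_eq:
  assumes "\<pi> (k + N) = \<pi> k" "n \<le> k + N"
  shows "unroll \<pi> k N n = \<pi> n"
  using assms by (cases "n = k + N") (auto simp: unroll_def)

text \<open>Each step of the unrolled sequence copies a step of \<open>\<pi>\<close> taken before
  time \<open>k + N\<close>, so it inherits every property of the edges of the lasso. Past the stem
  only edges of the cycle are copied.\<close>

lemma unroll_step:
  assumes "\<pi> (k + N) = \<pi> k" "0 < N"
  obtains m where "m < k + N" "k \<le> n \<Longrightarrow> k \<le> m"
    "unroll \<pi> k N n = \<pi> m" "unroll \<pi> k N (Suc n) = \<pi> (Suc m)"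
proof (cases "n < k")
  case True
  show ?thesis
  proof (rule that[of n])
    show "unroll \<pi> k N (Suc n) = \<pi> (Suc n)"
      using True assms by (intro unroll_eq) auto
  qed (use True in \<open>auto simp: unroll_def\<close>)
next
  case False
  \<comment> \<open>At the last position of the cycle the remainder jumps back to 0, which
    \<open>\<pi> (k + N) = \<pi> k\<close> makes up for.\<close>
  have "\<pi> (k + Suc (n - k) mod N) = \<pi> (Suc (k + (n - k) mod N))"
    using assms by (cases "Suc ((n - k) mod N) = N") (auto simp: mod_Suc simp flip: add_Suc_right)
  with False assms show ?thesis
    by (intro that[of "k + (n - k) mod N"]) (auto simp: unroll_def Suc_diff_le)
qed

text \<open>Moving the window by one drops the value at \<open>l\<close> and adds the equal value at
  \<open>l + N\<close>.\<close>

lemma inj_on_period_window: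
  fixes \<rho> :: "nat \<Rightarrow> 'v"
  assumes "\<And>n. k \<le> n \<Longrightarrow> \<rho> (n + N) = \<rho> n" "inj_on \<rho> {k..<k + N}" "k \<le> l"
  shows "inj_on \<rho> {l..<l + N}"
  using assms(3)
proof (induction l rule: dec_induct)
  case base
  then show ?case by (rule assms(2))
next
  case (step l)
  show ?case
  proof (cases "N = 0")
    case False
    have eq: "{Suc l..<Suc l + N} = insert (l + N) ({l..<l + N} - {l})"
      using False by auto
    have "\<rho> (l + N) = \<rho> l"
      using assms(1) step by simp
    moreover have "\<rho> l \<notin> \<rho> ` ({l..<l + N} - {l})"
      using inj_onD[OF step.IH] False by fastforce
    ultimately show ?thesis
      unfolding eq using step.IH by (auto intro: inj_on_diff)
  qed simp
qed

text \<open>Moving the window by one carries its first label to the end, which is exactly the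
  permutation that closure provides.\<close>

lemma closed_window_step:
  assumes cl: "closed_under_cyclic_permutations U Y"
    and "\<And>n. lab n \<in> U" "lab (l + N) = lab l" "0 < N" "map lab [l..<l + N] \<in> Y"
  shows "map lab [Suc l..<Suc l + N] \<in> Y"
proof -
  have "[l..<l + N] = l # [Suc l..<l + N]"
    using assms(4) by (simp add: upt_conv_Cons)
  then have "lab l # map lab [Suc l..<l + N] \<in> Y"
    using assms(5) by simp
  then have "map lab [Suc l..<l + N] @ [lab l] \<in> Y"
    using cl assms(2) unfolding closed_under_cyclic_permutations_def by (simp add: lists_eq_set image_subset_iff)
  then show ?thesis
    using assms(3,4) by simp
qed

text \<open>Closure only moves windows forward. The way back from \<open>l\<close> to
  \<open>k\<close> goes forward as well, to \<open>k + l * N\<close>, where by periodicity the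
  window carries the same word as at \<open>k\<close>.\<close>

lemma closed_window_iff:
  assumes cl: "closed_under_cyclic_permutations U Y"
    and U: "\<And>n. lab n \<in> U" and per: "\<And>n. k \<le> n \<Longrightarrow> lab (n + N) = lab n"
    and "0 < N" "k \<le> l"
  shows "map lab [l..<l + N] \<in> Y \<longleftrightarrow> map lab [k..<k + N] \<in> Y"
proof -
  have up: "map lab [m..<m + N] \<in> Y" if "map lab [a..<a + N] \<in> Y" "k \<le> a" "a \<le> m" for a m
    using that(3)
  proof (induction m rule: dec_induct)
    case base
    then show ?case using that(1) by simp
  next
    case (step m)
    with that per have "lab (m + N) = lab m" by simp
    from closed_window_step[where lab=lab, OF cl U this \<open>0 < N\<close> step.IH] show ?case .
  qed
  have mult: "lab (n + m * N) = lab n" if "k \<le> n" for n m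
  proof (induction m)
    case (Suc m)
    have "lab (n + Suc m * N) = lab ((n + m * N) + N)"
      by (simp add: ac_simps)
    also have "\<dots> = lab n"
      using per[of "n + m * N"] that Suc by simp
    finally show ?case .
  qed simp
  have "map lab [k + l * N..<(k + l * N) + N] = map lab [k..<k + N]"
    using mult[of "k + _" l] by (intro nth_equalityI) (simp_all add: ac_simps)
  moreover have "l \<le> k + l * N"
    using \<open>0 < N\<close> by (simp add: trans_le_add2)
  ultimately show ?thesis
    using up[of l "k + l * N"] up[of k l] \<open>k \<le> l\<close> by auto
qed

section \<open>Winning by the first cycle, and memoryless strategies as graphs\<close>

lemma play_in_vertices:
  assumes "wf_arena A" "\<pi> \<in> plays A"
  shows "\<pi> n \<in> vertices A"
  using assms by (auto simp: wf_arena_def plays_def)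

lemma play_lasso:
  assumes "wf_arena A" "\<pi> \<in> plays A"
  obtains k j where "lasso \<pi> k j"
proof -
  have "finite (vertices A)" "range \<pi> \<subseteq> vertices A"
    using assms play_in_vertices[OF assms] by (auto simp: wf_arena_def vertices_def)
  then show ?thesis
    using that lasso_exists finite_subset by metis
qed

lemma vertices_of_subset: "vertices_of A i \<subseteq> vertices A"
  by (cases i) (auto simp: vertices_def)

text \<open>The equivalence with \<open>i = Player0\<close> lets later arguments treat both players
  at once.\<close>

definition cycle_won :: "'l list set \<Rightarrow> ('v, 'l) arena \<Rightarrow> player \<Rightarrow> ('v \<times> 'v) list \<Rightarrow> bool" where
  "cycle_won Y A i es \<longleftrightarrow> (map (label A) es \<in> Y \<longleftrightarrow> i = Player0)"

lemma won_by_lasso: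
  assumes "\<pi> \<in> plays A" "lasso \<pi> k j"
  shows "won_by (O_FC Y A) i \<pi> \<longleftrightarrow> cycle_won Y A i (segment \<pi> k (Suc j))"
  using assms by (cases i) (auto simp: O_FC_def cycle_won_def first_cycle_lasso)

definition positional_moves ::
    "('v, 'l) arena \<Rightarrow> player \<Rightarrow> ('v \<Rightarrow> 'v) \<Rightarrow> ('v \<times> 'v) set" where
  "positional_moves A i f = {(v, w) \<in> edges A. v \<in> vertices_of A i \<longrightarrow> w = f v}"

definition paths :: "('v \<times> 'v) set \<Rightarrow> (nat \<Rightarrow> 'v) set" where
  "paths G = {\<pi>. \<forall>n. (\<pi> n, \<pi> (Suc n)) \<in> G}"

lemma positional_path_play: "\<pi> \<in> paths (positional_moves A i f) \<Longrightarrow> \<pi> \<in> plays A"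
  by (auto simp: paths_def positional_moves_def plays_def)

text \<open>Once a memoryless strategy is fixed, histories disappear: consistent plays are the
  infinite paths of a graph that keeps all edges of the opponent. Such paths can be shifted,
  extended at the front and unrolled.\<close>

lemma winning_from_memoryless:
  assumes wf: "wf_arena A" and mem: "memoryless A i S"
  shows "winning_from A W i S v \<longleftrightarrow>
    (\<forall>\<pi> \<in> paths (positional_moves A i (\<lambda>w. S [w])). \<pi> 0 = v \<longrightarrow> won_by W i \<pi>)"
proof -
  have "\<pi> \<in> paths (positional_moves A i (\<lambda>w. S [w])) \<longleftrightarrow> consistent A i S \<pi>"
    if "\<pi> \<in> plays A" for \<pi>
  proof -
    have "S (map \<pi> [0..<n] @ [\<pi> n]) = S ([] @ [\<pi> n])" if "\<pi> n \<in> vertices_of A i" for n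
      using mem that play_in_vertices[OF wf \<open>\<pi> \<in> plays A\<close>] unfolding memoryless_def
      by (metis (no_types, lifting) ex_map_conv in_listsI lists.Nil)
    then have "\<pi> (Suc n) = S (map \<pi> [0..<Suc n]) \<longleftrightarrow> \<pi> (Suc n) = S [\<pi> n]"
      if "\<pi> n \<in> vertices_of A i" for n
      using that by simp
    then show ?thesis
      using that by (auto simp: paths_def positional_moves_def consistent_def plays_def
          simp del: upt_Suc)
  qed
  then show ?thesis
    unfolding winning_from_def using positional_path_play by blast
qed

lemma positional_strategy:
  assumes "\<And>v. v \<in> vertices_of A i \<Longrightarrow> (v, f v) \<in> edges A"
  shows "strategy A i (\<lambda>u. f (last u))" "memoryless A i (\<lambda>u. f (last u))"
  using assms by (auto simp: strategy_def memoryless_def)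

text \<open>With \<open>k' = 0\<close> the whole lasso is unrolled. With \<open>k' = k\<close> only
  its cycle is, and then the stem may leave \<open>G\<close>.\<close>

lemma unroll_path:
  assumes "\<And>m. k' \<le> m \<Longrightarrow> m < k + N \<Longrightarrow> (\<pi> m, \<pi> (Suc m)) \<in> G"
    and "\<pi> (k + N) = \<pi> k" "0 < N" "k' = 0 \<or> k' = k"
  shows "(\<lambda>n. unroll \<pi> k N (n + k')) \<in> paths G"
proof -
  have "(unroll \<pi> k N (n + k'), unroll \<pi> k N (Suc (n + k'))) \<in> G" for n
    using unroll_step[OF assms(2,3), of "n + k'"] assms(1,4) by (metis le0 le_add2)
  then show ?thesis
    by (simp add: paths_def)
qed

section \<open>Solitaire arenas\<close>

text \<open>The player makes every move, and before the first repetition each vertex is left only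
  once, so the moves of \<open>\<pi>\<close> depend on the current vertex alone. Repeating them
  reproduces the first cycle.\<close>

lemma follow_lasso:
  assumes wf: "wf_arena A" and all: "vertices_of A p = vertices A"
    and \<pi>: "\<pi> \<in> plays A" and won: "won_by (O_FC Y A) p \<pi>"
  shows "\<exists>S. strategy A p S \<and> memoryless A p S \<and> winning_from A (O_FC Y A) p S (\<pi> 0)"
proof -
  obtain k j where l: "lasso \<pi> k j"
    using play_lasso[OF wf \<pi>] .
  then have inj: "inj_on \<pi> {..j}"
    by (simp add: lasso_def)
  \<comment> \<open>\<open>inv_into\<close> recovers the time at which \<open>\<pi>\<close> visits
    \<open>v\<close>; elsewhere any edge will do, to keep the strategy legal.\<close>
  define f where "f v = (if v \<in> \<pi> ` {..j} then \<pi> (Suc (inv_into {..j} \<pi> v))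
    else SOME w. (v, w) \<in> edges A)" for v
  have f\<pi>: "f (\<pi> n) = \<pi> (Suc n)" if "n \<le> j" for n
    using that inj by (simp add: f_def inv_into_f_f)
  have "(v, f v) \<in> edges A" if "v \<in> vertices A" for v
  proof (cases "v \<in> \<pi> ` {..j}")
    case True
    then show ?thesis
      using f\<pi> \<pi> by (auto simp: plays_def)
  next
    case False
    then show ?thesis
      using wf that unfolding f_def wf_arena_def by (auto intro: someI)
  qed
  then have S: "strategy A p (\<lambda>u. f (last u))" "memoryless A p (\<lambda>u. f (last u))"
    using all by (auto intro: positional_strategy)
  have "won_by (O_FC Y A) p \<rho>"
    if \<rho>: "\<rho> \<in> paths (positional_moves A p f)" "\<rho> 0 = \<pi> 0" for \<rho>
  proof -
    have play: "\<rho> \<in> plays A"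
      using \<rho>(1) by (rule positional_path_play)
    have eq: "\<rho> n = \<pi> n" if "n \<le> Suc j" for n
      using that
    proof (induction n)
      case (Suc n)
      have "\<rho> (Suc n) = f (\<rho> n)"
        using \<rho>(1) all play_in_vertices[OF wf play] by (auto simp: paths_def positional_moves_def)
      with Suc f\<pi> show ?case by simp
    qed (rule \<rho>(2))
    have "segment \<rho> k (Suc j) = segment \<pi> k (Suc j)"
      using eq by (intro segment_cong) simp
    with won show ?thesis
      by (simp add: won_by_lasso[OF \<pi> l] won_by_lasso[OF play lasso_cong[OF l eq]])
  qed
  with S show ?thesis
    by (auto simp: winning_from_memoryless[OF wf S(2)])
qed

text \<open>Excludes winning vacuously for lack of consistent plays, which is what makes the winning
  regions disjoint.\<close>

lemma consistent_play_exists: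
  assumes wf: "wf_arena A" and all: "vertices_of A p = vertices A"
    and S: "strategy A p S" and v: "v \<in> vertices A"
  obtains \<pi> where "\<pi> \<in> plays A" "\<pi> 0 = v" "consistent A p S \<pi>"
proof -
  \<comment> \<open>\<open>h n\<close> is the history of \<open>n + 1\<close> vertices obtained by
    iterating the strategy from \<open>v\<close>.\<close>
  define h where "h n = ((\<lambda>u. u @ [S u]) ^^ n) [v]" for n
  define \<pi> where "\<pi> n = last (h n)" for n
  have h: "h n = map \<pi> [0..<Suc n]" for n
    by (induction n) (auto simp: h_def \<pi>_def)
  have step: "\<pi> (Suc n) = S (map \<pi> [0..<Suc n])" for n
  proof -
    have "h (Suc n) = h n @ [S (h n)]"
      by (simp add: h_def)
    then show ?thesis
      unfolding \<pi>_def h[symmetric] by simp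
  qed
  have edge: "(\<pi> n, \<pi> (Suc n)) \<in> edges A" if "\<And>m. m \<le> n \<Longrightarrow> \<pi> m \<in> vertices A" for n
  proof -
    have "map \<pi> [0..<n] \<in> lists (vertices A)"
      using that by (auto simp: lists_eq_set)
    then have "(\<pi> n, S (map \<pi> [0..<n] @ [\<pi> n])) \<in> edges A"
      using S that all unfolding strategy_def by blast
    then show ?thesis
      by (simp add: step)
  qed
  \<comment> \<open>Legality of a move presupposes that the whole history lies in the arena, hence
    the strong induction.\<close>
  have "\<pi> n \<in> vertices A" for n
  proof (induction n rule: less_induct)
    case (less n)
    show ?case
    proof (cases n)
      case 0
      then show ?thesis
        using v by (simp add: \<pi>_def h_def)
    next
      case (Suc m)
      then have "(\<pi> m, \<pi> n) \<in> edges A"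
        using edge[of m] less by auto
      then show ?thesis
        using wf by (auto simp: wf_arena_def)
    qed
  qed
  then have "\<pi> \<in> plays A"
    using edge by (simp add: plays_def)
  then show ?thesis
    using that step by (simp add: \<pi>_def h_def consistent_def)
qed

lemma won_by_opponent: "p \<noteq> q \<Longrightarrow> won_by W q \<pi> \<longleftrightarrow> \<not> won_by W p \<pi>"
  by (cases p; cases q) auto

text \<open>For \<open>q\<close>, who never moves, every function is a memoryless strategy and every
  play is consistent. So either all plays from \<open>v\<close> are won by \<open>q\<close>, or one
  is won by \<open>p\<close>, who can follow its lasso.\<close>

lemma solitaire_pointwise_memoryless_determined:
  assumes wf: "wf_arena A" and pq: "p \<noteq> q" and q: "vertices_of A q = {}"
  shows "pointwise_memoryless_determined A (O_FC Y A)"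
proof -
  let ?W = "O_FC Y A"
  have players: "i = p \<or> i = q" for i
    using pq by (cases i; cases p; cases q) auto
  have all: "vertices_of A p = vertices A"
    using pq q by (cases p; cases q) (auto simp: vertices_def)
  have q_any: "strategy A q S" "memoryless A q S" "consistent A q S \<pi>" for S \<pi>
    using q by (auto simp: strategy_def memoryless_def consistent_def)
  have p_wins: "\<exists>S. strategy A p S \<and> memoryless A p S \<and> winning_from A ?W p S (\<pi> 0)"
    if "\<pi> \<in> plays A" "\<not> won_by ?W q \<pi>" for \<pi>
    using follow_lasso[OF wf all that(1)] that(2) won_by_opponent[OF pq] by metis
  have cover: "(\<exists>S. winning_from A ?W q S v) \<or>
      (\<exists>S. strategy A p S \<and> memoryless A p S \<and> winning_from A ?W p S v)" for v
    using p_wins unfolding winning_from_def by metis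
  have disjoint: "\<not> winning_from A ?W q S' v"
    if S: "strategy A p S" "winning_from A ?W p S v" and v: "v \<in> vertices A" for S S' v
  proof -
    obtain \<pi> where "\<pi> \<in> plays A" "\<pi> 0 = v" "consistent A p S \<pi>"
      using consistent_play_exists[OF wf all S(1) v] .
    then show ?thesis
      using S(2) q_any(3) won_by_opponent[OF pq] unfolding winning_from_def by metis
  qed
  have "winning_region A ?W p \<union> winning_region A ?W q = vertices A"
    "winning_region A ?W p \<inter> winning_region A ?W q = {}"
    using cover q_any(1) disjoint unfolding winning_region_def by blast+
  then have "determined A ?W"
    using players[of Player0] players[of Player1] pq unfolding determined_def by auto
  moreover have "pointwise_memoryless A ?W q"
    using q_any by (auto simp: pointwise_memoryless_def winning_region_def)
  moreover have "pointwise_memoryless A ?W p"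
    unfolding pointwise_memoryless_def
  proof
    fix v
    assume "v \<in> winning_region A ?W p"
    then have "\<not> winning_from A ?W q S v" for S
      using disjoint by (auto simp: winning_region_def)
    then show "\<exists>S. strategy A p S \<and> memoryless A p S \<and> winning_from A ?W p S v"
      using cover by blast
  qed
  ultimately show ?thesis
    using players unfolding pointwise_memoryless_determined_def by metis
qed

section \<open>A solitaire arena without a uniform memoryless winning strategy\<close>

text \<open>From \<open>0\<close> the only winning first cycle is \<open>0 1 0\<close>, from \<open>2\<close> it is \<open>2 1 2\<close>; these require
  different moves at \<open>1\<close>.\<close>

definition path_arena :: "(nat, nat) arena" where
  "path_arena = \<lparr>vertices0 = {0, 1, 2}, vertices1 = {}, edges = {(0, 1), (1, 0), (1, 2), (2, 1)},
     labels = {0, 1}, label = (\<lambda>e. if fst e = 1 then 1 else 0)\<rparr>"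

lemma wf_path_arena: "wf_arena path_arena"
  by (auto simp: wf_arena_def path_arena_def vertices_def)

text \<open>Label 1 marks the edges leaving vertex \<open>1\<close>, so the word
  \<open>[0, 1]\<close> singles out the two-cycles entered at an end; oscillating between
  \<open>a\<close> and \<open>1\<close> yields it.\<close>

lemma path_arena_end_winning:
  assumes "a \<in> {0, 2}"
  shows "a \<in> winning_region path_arena (O_FC {[0, 1]} path_arena) Player0"
proof -
  define \<pi> where "\<pi> n = (if even n then a else 1)" for n :: nat
  have play: "\<pi> \<in> plays path_arena"
    using assms by (auto simp: \<pi>_def plays_def path_arena_def)
  have "lasso \<pi> 0 1"
    using assms by (auto simp: lasso_def \<pi>_def inj_on_def le_Suc_eq)
  moreover have "cycle_won {[0, 1]} path_arena Player0 (segment \<pi> 0 (Suc 1))"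
    using assms by (auto simp: cycle_won_def segment_def \<pi>_def path_arena_def)
  ultimately have "won_by (O_FC {[0, 1]} path_arena) Player0 \<pi>"
    using won_by_lasso[OF play] by blast
  moreover have "vertices_of path_arena Player0 = vertices path_arena" "a \<in> vertices path_arena"
    using assms by (auto simp: path_arena_def vertices_def)
  moreover have "\<pi> 0 = a"
    by (simp add: \<pi>_def)
  ultimately show ?thesis
    using follow_lasso[OF wf_path_arena _ play] unfolding winning_region_def by blast
qed

lemma path_arena_not_uniform:
  "\<not> uniform_memoryless path_arena (O_FC {[0, 1]} path_arena) Player0"
proof
  let ?W = "O_FC {[0, 1]} path_arena"
  assume "uniform_memoryless path_arena ?W Player0"
  then obtain S where S: "strategy path_arena Player0 S" and mem: "memoryless path_arena Player0 S"
    and win: "\<And>v. v \<in> winning_region path_arena ?W Player0 \<Longrightarrow> winning_from path_arena ?W Player0 S v"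
    unfolding uniform_memoryless_def by blast
  have edge: "(v, S [v]) \<in> edges path_arena" if "v \<in> {0, 1, 2}" for v
  proof -
    have "v \<in> vertices_of path_arena Player0"
      using that by (simp add: path_arena_def)
    then have "(v, S ([] @ [v])) \<in> edges path_arena"
      using S unfolding strategy_def by blast
    then show ?thesis by simp
  qed
  \<comment> \<open>\<open>b\<close> is the end to which the strategy commits at vertex
    \<open>1\<close>. From the other end \<open>a\<close> the play is a, 1, b, 1, ..., whose first
    cycle starts at \<open>1\<close> and reads \<open>[1, 0]\<close>.\<close>
  obtain a b where ab: "S [1] = b" "{a, b} = {0, 2}"
    using edge[of 1] by (auto simp: path_arena_def)
  define \<pi> where "\<pi> n = (if n = 0 then a else if even n then b else 1)" for n :: nat
  have "S [0] = 1" "S [2] = 1"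
    using edge[of 0] edge[of 2] by (auto simp: path_arena_def)
  then have path: "\<pi> \<in> paths (positional_moves path_arena Player0 (\<lambda>w. S [w]))"
    using ab by (auto simp: \<pi>_def paths_def positional_moves_def path_arena_def doubleton_eq_iff)
  have "{..2} = {0, 1, 2 :: nat}"
    by auto
  then have "lasso \<pi> 1 2"
    using ab by (auto simp: lasso_def \<pi>_def doubleton_eq_iff)
  moreover have "\<not> cycle_won {[0, 1]} path_arena Player0 (segment \<pi> 1 (Suc 2))"
    by (simp add: cycle_won_def segment_def \<pi>_def path_arena_def numeral_2_eq_2)
  ultimately have "\<not> won_by ?W Player0 \<pi>"
    using won_by_lasso[OF positional_path_play[OF path]] by blast
  moreover have "a \<in> {0, 2}"
    using ab(2) by blast
  ultimately show False
    using win[OF path_arena_end_winning] path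
    by (auto simp: winning_from_memoryless[OF wf_path_arena mem] \<pi>_def)
qed

section \<open>Cycle properties closed under cyclic permutations\<close>

text \<open>The cases ask where the lasso of the play from \<open>w\<close> meets \<open>v\<close>:
  nowhere, on the stem, or on the cycle. Only the last one appeals to closure.\<close>

lemma winning_from_step:
  assumes wf: "wf_arena A" and cl: "closed_under_cyclic_permutations (labels A) Y"
    and mem: "memoryless A i S" and win: "winning_from A (O_FC Y A) i S v"
    and vw: "(v, w) \<in> positional_moves A i (\<lambda>x. S [x])"
  shows "winning_from A (O_FC Y A) i S w"
  unfolding winning_from_memoryless[OF wf mem]
proof (intro ballI impI)
  let ?G = "positional_moves A i (\<lambda>x. S [x])"
  fix \<pi>
  assume \<pi>: "\<pi> \<in> paths ?G" "\<pi> 0 = w"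
  have v_wins: "won_by (O_FC Y A) i \<rho>" if "\<rho> \<in> paths ?G" "\<rho> 0 = v" for \<rho>
    using win that by (simp add: winning_from_memoryless[OF wf mem])
  have play: "\<pi> \<in> plays A"
    using \<pi>(1) by (rule positional_path_play)
  obtain k j where l: "lasso \<pi> k j"
    using play_lasso[OF wf play] .
  then have kj: "k \<le> j" and inj: "inj_on \<pi> {..j}" and close: "\<pi> (Suc j) = \<pi> k"
    by (auto simp: lasso_def)
  have "cycle_won Y A i (segment \<pi> k (Suc j))"
  proof (cases "v \<in> \<pi> ` {..j}")
    case False
    define \<rho> where "\<rho> = case_nat v \<pi>"
    have path: "\<rho> \<in> paths ?G"
      using \<pi> vw by (auto simp: \<rho>_def paths_def split: nat.split)
    have "inj_on \<rho> {..Suc j}"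
      using inj False by (auto simp: \<rho>_def inj_on_def split: nat.splits)
    then have "lasso \<rho> (Suc k) (Suc j)"
      using kj close by (simp add: lasso_def \<rho>_def)
    moreover have "segment \<rho> (Suc k) (Suc (Suc j)) = segment \<pi> k (Suc j)"
      using segment_shift[of \<rho> 1 k "Suc j"] by (simp add: \<rho>_def)
    ultimately show ?thesis
      using v_wins[OF path] won_by_lasso[OF positional_path_play[OF path]] by (simp add: \<rho>_def)
  next
    case True
    then obtain l where l: "l \<le> j" "v = \<pi> l" by auto
    define N where "N = Suc j - k"
    have N: "0 < N" "k + N = Suc j"
      using kj by (auto simp: N_def)
    \<comment> \<open>After time \<open>Suc j\<close> the play \<open>\<pi>\<close> may leave the
      cycle; the unrolled play stays on it, so starting at a later position still closes it.\<close>
    define \<sigma> where "\<sigma> = unroll \<pi> k N"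
    have \<sigma>eq: "\<sigma> n = \<pi> n" if "n \<le> Suc j" for n
      unfolding \<sigma>_def using that N close by (intro unroll_eq) auto
    have per: "\<sigma> (n + N) = \<sigma> n" if "k \<le> n" for n
      unfolding \<sigma>_def using that by (rule unroll_period)
    have path\<sigma>: "\<sigma> \<in> paths ?G"
      using unroll_path[of 0 k N \<pi> ?G] \<pi>(1) N close by (simp add: \<sigma>_def paths_def)
    have inj\<sigma>: "inj_on \<sigma> {..j}"
      using inj \<sigma>eq inj_on_cong[of "{..j}" \<sigma> \<pi>] by simp
    define \<rho> where "\<rho> = (\<lambda>n. \<sigma> (n + l))"
    have path: "\<rho> \<in> paths ?G"
      using path\<sigma> by (simp add: \<rho>_def paths_def)
    have \<rho>0: "\<rho> 0 = v"
      using l \<sigma>eq by (simp add: \<rho>_def)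
    have seg: "segment \<sigma> k (Suc j) = segment \<pi> k (Suc j)"
      using \<sigma>eq by (intro segment_cong) simp
    show ?thesis
    proof (cases "l \<le> k")
      \<comment> \<open>\<open>v\<close> lies on the stem or is the entry of the cycle: the play
        from \<open>v\<close> enters the cycle at the same vertex, with all times reduced by
        \<open>l\<close>.\<close>
      case True
      have "inj_on \<rho> {..j - l}"
      proof (rule inj_onI)
        fix x y
        assume "x \<in> {..j - l}" "y \<in> {..j - l}" "\<rho> x = \<rho> y"
        then show "x = y"
          using inj_onD[OF inj\<sigma>, of "x + l" "y + l"] True kj by (simp add: \<rho>_def)
      qed
      then have "lasso \<rho> (k - l) (j - l)"
        using True kj \<sigma>eq close by (simp add: lasso_def \<rho>_def)
      moreover have "segment \<rho> (k - l) (Suc (j - l)) = segment \<sigma> k (Suc j)"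
        using True kj segment_shift[of \<sigma> l "k - l" "Suc (j - l)"] by (simp add: \<rho>_def)
      ultimately show ?thesis
        using v_wins[OF path \<rho>0] won_by_lasso[OF positional_path_play[OF path]] seg by metis
    next
      \<comment> \<open>\<open>v\<close> lies on the cycle beyond its entry: the play from
        \<open>v\<close> closes the same cycle after \<open>N\<close> steps, but reads it from
        position \<open>l\<close>.\<close>
      case False
      have inj_l: "inj_on \<sigma> {l..<l + N}"
      proof (rule inj_on_period_window)
        show "\<sigma> (n + N) = \<sigma> n" if "k \<le> n" for n
          using that by (rule per)
        show "inj_on \<sigma> {k..<k + N}"
          by (rule inj_on_subset[OF inj\<sigma>]) (use N in auto)
      qed (use False in simp)
      have "inj_on \<rho> {..N - 1}"
      proof (rule inj_onI)
        fix x y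
        assume "x \<in> {..N - 1}" "y \<in> {..N - 1}" "\<rho> x = \<rho> y"
        then show "x = y"
          using inj_onD[OF inj_l, of "x + l" "y + l"] N by (auto simp: \<rho>_def)
      qed
      moreover have "\<rho> N = \<rho> 0"
        using per[of l] False by (simp add: \<rho>_def add.commute)
      ultimately have "lasso \<rho> 0 (N - 1)"
        using N by (simp add: lasso_def)
      then have "cycle_won Y A i (segment \<rho> 0 N)"
        using v_wins[OF path \<rho>0] won_by_lasso[OF positional_path_play[OF path]] N
        by (metis Suc_pred')
      moreover have "segment \<rho> 0 N = segment \<sigma> l (l + N)"
        using segment_shift[of \<sigma> l 0 N] by (simp add: \<rho>_def add.commute)
      moreover define lab where "lab n = label A (\<sigma> n, \<sigma> (Suc n))" for n
      moreover have "map lab [l..<l + N] \<in> Y \<longleftrightarrow> map lab [k..<k + N] \<in> Y"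
      proof (rule closed_window_iff[OF cl])
        show "lab n \<in> labels A" for n
          using wf positional_path_play[OF path\<sigma>] by (auto simp: lab_def wf_arena_def plays_def)
        show "lab (n + N) = lab n" if "k \<le> n" for n
          using per[of n] per[of "Suc n"] that by (simp add: lab_def)
      qed (use N False in auto)
      moreover have "map (label A) (segment \<sigma> m n) = map lab [m..<n]" for m n
        by (simp add: lab_def segment_def)
      ultimately show ?thesis
        using N by (simp add: cycle_won_def seg[symmetric] del: upt_Suc)
    qed
  qed
  then show "won_by (O_FC Y A) i \<pi>"
    by (simp add: won_by_lasso[OF play l])
qed

lemma winning_from_reachable:
  assumes "wf_arena A" "closed_under_cyclic_permutations (labels A) Y"
    and "memoryless A i S" "winning_from A (O_FC Y A) i S v"
    and "(v, w) \<in> (positional_moves A i (\<lambda>x. S [x]))\<^sup>*"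
  shows "winning_from A (O_FC Y A) i S w"
  using assms(5)
proof induction
  case base
  show ?case by (rule assms(4))
next
  case (step x y)
  from winning_from_step[OF assms(1-3) step.IH step.hyps(2)] show ?case .
qed

lemma uniform_if_pointwise:
  assumes wf: "wf_arena A" and cl: "closed_under_cyclic_permutations (labels A) Y"
    and pw: "pointwise_memoryless A (O_FC Y A) i"
  shows "uniform_memoryless A (O_FC Y A) i"
proof -
  let ?O = "O_FC Y A"
  define W where "W = winning_region A ?O i"
  obtain F where F: "strategy A i (F v)" "memoryless A i (F v)" "winning_from A ?O i (F v) v"
    if "v \<in> W" for v
    using pw unfolding pointwise_memoryless_def W_def by metis
  define M where "M v = positional_moves A i (\<lambda>x. F v [x])" for v
  have WV: "W \<subseteq> vertices A"
    by (auto simp: W_def winning_region_def)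
  have "finite W"
    using wf WV by (auto simp: wf_arena_def vertices_def intro: finite_subset)
  then obtain idx :: "'a \<Rightarrow> nat" where idx: "inj_on idx W"
    using finite_imp_inj_to_nat_seg by metis
  have reach_win: "winning_from A ?O i (F v) w" if "v \<in> W" "(v, w) \<in> (M v)\<^sup>*" for v w
    using winning_from_reachable[OF wf cl F(2,3)] that by (simp add: M_def)
  \<comment> \<open>The strategy of \<open>v\<close> itself witnesses that every vertex it can reach
    is winning.\<close>
  have reach_W: "w \<in> W" if "v \<in> W" "(v, w) \<in> (M v)\<^sup>*" for v w
  proof -
    have "w \<in> vertices A"
      using that(2)
      by cases (use that WV wf in \<open>auto simp: M_def positional_moves_def wf_arena_def\<close>)
    with that reach_win F(1) show ?thesis
      unfolding W_def winning_region_def by blast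
  qed
  \<comment> \<open>\<open>g w\<close> is the owner of \<open>w\<close>, whose strategy is used
    there. Candidates exist because \<open>w\<close> reaches itself.\<close>
  define g where "g w = arg_min idx (\<lambda>v. v \<in> W \<and> (v, w) \<in> (M v)\<^sup>*)" for w
  have g: "g w \<in> W" "(g w, w) \<in> (M (g w))\<^sup>*" if "w \<in> W" for w
    using arg_min_natI[of "\<lambda>v. v \<in> W \<and> (v, w) \<in> (M v)\<^sup>*" w idx] that by (auto simp: g_def)
  have g_le: "idx (g w) \<le> idx v" if "v \<in> W" "(v, w) \<in> (M v)\<^sup>*" for v w
    unfolding g_def using that by (intro arg_min_nat_le) auto
  define f where "f w = (if w \<in> W then F (g w) [w] else SOME x. (w, x) \<in> edges A)" for w
  have "(v, f v) \<in> edges A" if v: "v \<in> vertices_of A i" for v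
  proof (cases "v \<in> W")
    case True
    then have "(v, F (g v) ([] @ [v])) \<in> edges A"
      using F(1)[OF g(1)] v unfolding strategy_def by blast
    with True show ?thesis by (simp add: f_def)
  next
    case False
    then show ?thesis
      using wf v vertices_of_subset[of A i] unfolding f_def wf_arena_def by (auto intro: someI)
  qed
  then have S: "strategy A i (\<lambda>u. f (last u))" "memoryless A i (\<lambda>u. f (last u))"
    by (auto intro: positional_strategy)
  have "won_by ?O i \<pi>" if \<pi>: "\<pi> \<in> paths (positional_moves A i f)" "\<pi> 0 \<in> W" for \<pi>
  proof -
    have play: "\<pi> \<in> plays A"
      using \<pi>(1) by (rule positional_path_play)
    have move: "(\<pi> n, \<pi> (Suc n)) \<in> M (g (\<pi> n))" if "\<pi> n \<in> W" for n
      using \<pi>(1) that by (auto simp: paths_def M_def positional_moves_def f_def)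
    \<comment> \<open>The move at \<open>\<pi> n\<close> obeys its owner, so this owner remains a
      candidate at the next vertex and the index cannot rise.\<close>
    then have reach: "(g (\<pi> n), \<pi> (Suc n)) \<in> (M (g (\<pi> n)))\<^sup>*" if "\<pi> n \<in> W" for n
      using g(2) that by (meson rtrancl.rtrancl_into_rtrancl)
    have inW: "\<pi> n \<in> W" for n
      by (induction n) (use \<pi>(2) reach reach_W g(1) in auto)
    have "idx (g (\<pi> (Suc n))) \<le> idx (g (\<pi> n))" for n
      using g_le[OF g(1) reach] inW by blast
    then have mono: "idx (g (\<pi> n)) \<le> idx (g (\<pi> m))" if "m \<le> n" for m n
      using that by (rule lift_Suc_antimono_le[of "\<lambda>n. idx (g (\<pi> n))"])
    obtain k j where l: "lasso \<pi> k j"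
      using play_lasso[OF wf play] .
    then have kj: "k \<le> j" and inj: "inj_on \<pi> {..j}" and close: "\<pi> (Suc j) = \<pi> k"
      by (auto simp: lasso_def)
    \<comment> \<open>The index is antitone and returns to its value at \<open>k\<close> when the
      cycle closes; injectivity of \<open>idx\<close> turns equal indices into equal owners.\<close>
    have const: "g (\<pi> n) = g (\<pi> k)" if "k \<le> n" "n \<le> Suc j" for n
    proof -
      have "idx (g (\<pi> n)) = idx (g (\<pi> k))"
        using mono[OF that(1)] mono[OF that(2)] close by simp
      then show ?thesis
        using idx g(1) inW by (auto dest: inj_onD)
    qed
    define N where "N = Suc j - k"
    have N: "0 < N" "k + N = Suc j"
      using kj by (auto simp: N_def)
    \<comment> \<open>Only the cycle is unrolled, since the stem may mix moves of several
      owners.\<close>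
    define \<rho> where "\<rho> = (\<lambda>n. unroll \<pi> k N (n + k))"
    have path: "\<rho> \<in> paths (M (g (\<pi> k)))"
      unfolding \<rho>_def
    proof (rule unroll_path)
      show "(\<pi> m, \<pi> (Suc m)) \<in> M (g (\<pi> k))" if "k \<le> m" "m < k + N" for m
        using move[OF inW, of m] const[of m] that N by simp
    qed (use N close in auto)
    have \<rho>eq: "\<rho> n = \<pi> (n + k)" if "n \<le> N" for n
      unfolding \<rho>_def using that N close by (intro unroll_eq) auto
    have "inj_on \<rho> {..N - 1}"
    proof (rule inj_onI)
      fix x y
      assume "x \<in> {..N - 1}" "y \<in> {..N - 1}" "\<rho> x = \<rho> y"
      then show "x = y"
        using inj_onD[OF inj, of "x + k" "y + k"] \<rho>eq[of x] \<rho>eq[of y] N by auto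
    qed
    then have "lasso \<rho> 0 (N - 1)"
      using N \<rho>eq[of 0] \<rho>eq[of N] close by (simp add: lasso_def add.commute)
    moreover have "segment \<rho> 0 N = segment \<pi> k (Suc j)"
    proof -
      have "segment \<rho> 0 N = segment (\<lambda>n. \<pi> (n + k)) 0 N"
        using \<rho>eq by (intro segment_cong) simp
      also have "\<dots> = segment \<pi> k (Suc j)"
        using N(2) by (simp add: segment_shift add.commute)
      finally show ?thesis .
    qed
    \<comment> \<open>The owner's strategy can reach \<open>\<pi> k\<close>, hence also wins from
      there.\<close>
    moreover have "won_by ?O i \<rho>"
    proof -
      have "\<rho> 0 = \<pi> k"
        using \<rho>eq[of 0] by simp
      then show ?thesis
        using reach_win[OF g(1) g(2)] inW path
        by (auto simp: winning_from_memoryless[OF wf F(2)[OF g(1)]] M_def)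
    qed
    moreover have "\<rho> \<in> plays A"
      using path unfolding M_def by (rule positional_path_play)
    ultimately show ?thesis
      using won_by_lasso[of \<rho> A 0 "N - 1"] won_by_lasso[OF play l] N(1) by simp
  qed
  then have "winning_from A ?O i (\<lambda>u. f (last u)) v" if "v \<in> W" for v
    using that by (auto simp: winning_from_memoryless[OF wf S(2)])
  with S show ?thesis
    unfolding uniform_memoryless_def W_def[symmetric] by blast
qed

theorem theorem1:
  shows "(\<forall>(U :: 'l set) Y (A :: ('v, 'l) arena).
            cycle_property U Y \<and> wf_arena A \<and> labels A = U \<and>
            (vertices0 A = {} \<or> vertices1 A = {}) \<longrightarrow>
            pointwise_memoryless_determined A (O_FC Y A)) \<and>
         (\<exists>(U :: nat set) Y (A :: (nat, nat) arena).
            cycle_property U Y \<and> wf_arena A \<and> labels A = U \<and>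
            (vertices0 A = {} \<or> vertices1 A = {}) \<and>
            \<not> uniform_memoryless_determined A (O_FC Y A)) \<and>
         (\<forall>(U :: 'l set) Y (A :: ('v, 'l) arena) i.
            cycle_property U Y \<and> closed_under_cyclic_permutations U Y \<and>
            wf_arena A \<and> labels A = U \<and>
            pointwise_memoryless A (O_FC Y A) i \<longrightarrow>
            uniform_memoryless A (O_FC Y A) i)"
proof (intro conjI allI impI)
  fix U :: "'l set" and Y and A :: "('v, 'l) arena"
  assume *: "cycle_property U Y \<and> wf_arena A \<and> labels A = U \<and>
    (vertices0 A = {} \<or> vertices1 A = {})"
  then consider "vertices_of A Player0 = {}" | "vertices_of A Player1 = {}"
    by auto
  then show "pointwise_memoryless_determined A (O_FC Y A)"
    using * solitaire_pointwise_memoryless_determined[of A Player0 Player1]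
      solitaire_pointwise_memoryless_determined[of A Player1 Player0] by cases auto
next
  show "\<exists>(U :: nat set) Y (A :: (nat, nat) arena).
      cycle_property U Y \<and> wf_arena A \<and> labels A = U \<and>
      (vertices0 A = {} \<or> vertices1 A = {}) \<and>
      \<not> uniform_memoryless_determined A (O_FC Y A)"
  proof (intro exI conjI)
    show "cycle_property {0, 1} {[0, 1]}"
      by (simp add: cycle_property_def)
    show "labels path_arena = {0, 1}" "vertices0 path_arena = {} \<or> vertices1 path_arena = {}"
      by (simp_all add: path_arena_def)
    show "\<not> uniform_memoryless_determined path_arena (O_FC {[0, 1]} path_arena)"
      using path_arena_not_uniform by (auto simp: uniform_memoryless_determined_def)
  qed (rule wf_path_arena)
next
  fix U :: "'l set" and Y and A :: "('v, 'l) arena" and i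
  assume "cycle_property U Y \<and> closed_under_cyclic_permutations U Y \<and>
    wf_arena A \<and> labels A = U \<and> pointwise_memoryless A (O_FC Y A) i"
  then show "uniform_memoryless A (O_FC Y A) i"
    using uniform_if_pointwise by blast
qed

end
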